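(* For $j\in[p]=\{1,\dots,p\}$ let $h^j=f^j+g^j$ with $f^j:\mathbb{R}^n\to\mathbb{R}^m$ continuously differentiable and $g^j:\mathbb{R}^n\to\mathbb{R}^m\cup\{+\infty_C\}$ proper, closed and $C$-convex, let $H(x)=\{h^1(x),\dots,h^p(x)\}$, and consider the set optimization problem $\preceq^\ell$-$\min_{x\in\mathbb{R}^n}H(x)$. Let $\bar y\in\mathbb{R}^n$. Then $\bar y$ is a local weakly minimal solution of the set optimization problem if, for every $a\in P_{\bar y}$, $\bar y$ is a local weakly efficient solution of the vector optimization problem $\preceq_{\tilde C}$-$\min_{x\in\mathbb{R}^n}\tilde h^a(x)$, where $\tilde h^a(x)=(h^{a_1}(x),\dots,h^{a_{\omega(\bar y)}}(x))$ and $\tilde C=C\times\cdots\times C$ ($\omega(\bar y)$ times).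
   Context: $C\subset\mathbb{R}^m$ is a closed, convex, pointed cone with nonempty interior; $w\preceq_C w'$ iff $w'-w\in C$, $w\prec_C w'$ iff $w'-w\in\mathrm{int}(C)$. The extra element $+\infty_C$ satisfies $w\prec_C+\infty_C$ for all $w\in\mathbb{R}^m$. For sets, $U\prec^\ell V$ iff $V\subseteq U+\mathrm{int}(C)$, i.e. for every $v\in V$ there is $u\in U$ with $u\prec_C v$; $U\preceq^\ell V$ iff $V\subseteq U+C$. A function $g:\mathbb{R}^n\to\mathbb{R}^m\cup\{+\infty_C\}$ is $C$-convex if $g(\lambda x+(1-\lambda)y)\preceq_C\lambda g(x)+(1-\lambda)g(y)$ for all $x,y$ and $\lambda\in(0,1]$; proper if not identically $+\infty_C$; closed if $x\mapsto z^\top g(x)$ is lower semicontinuous for every $z\in C^*\setminus\{0\}$, where $C^*=\{z:w^\top z\ge0\ \forall w\in C\}$ and $z^\top(+\infty_C):=+\infty$. In particular each $h^j$ is lower semicontinuous in this sense. Minimal set: $\mathcal{M}(U,C):=\{u\in U:\nexists\,u'\in U,\ u'\ne u,\ u'\preceq_C u\}$. Cardinality function: $\omega(x):=|\mathcal{M}(H(x),C)|$. Partition set: enumerate $\mathcal{M}(H(x),C)=\{u_1^x,\dots,u_{\omega(x)}^x\}$ and, with $I_u(x):=\{j\in[p]:h^j(x)=u\}$, put $P_x:=\prod_{j=1}^{\omega(x)}I_{u_j^x}(x)$; elements are written $a=(a_1,\dots,a_{\omega(x)})$. $\bar y$ is a local weakly minimal solution of the set problem if there is a neighborhood $N$ of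 $\bar y$ such that no $y\in N$ satisfies $H(y)\prec^\ell H(\bar y)$. $\bar y$ is a local weakly efficient solution of $\preceq_{\tilde C}$-$\min\tilde h^a$ if there is a neighborhood $N$ of $\bar y$ such that no $y\in N$ satisfies $h^{a_j}(y)\prec_C h^{a_j}(\bar y)$ for all $j\in\{1,\dots,\omega(\bar y)\}$. *)

theory Defs
  imports "HOL-Analysis.Analysis"
begin

text \<open>The extended image space: \<open>'w\<close> (in the application \<open>real ^ 'm\<close>) with one extra
  element \<open>PInf\<close>, playing the role of \<open>+\<infinity>\<^sub>C\<close>.\<close>

datatype 'w cext = Fin 'w | PInf

fun cext_add :: "'w::real_vector cext \<Rightarrow> 'w cext \<Rightarrow> 'w cext" where
  "cext_add (Fin v) (Fin w) = Fin (v + w)"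
| "cext_add PInf _ = PInf"
| "cext_add _ PInf = PInf"

text \<open>Only scalars in \<open>[0, 1]\<close> are used below. The value of \<open>0 \<cdot> (+\<infinity>\<^sub>C)\<close> is a convention which
  only enters \<open>C_convex\<close> for \<open>t = 1\<close>; the inequality required there holds trivially, whether
  this value is \<open>+\<infinity>\<^sub>C\<close> or \<open>0\<close>.\<close>

fun cext_scale :: "real \<Rightarrow> 'w::real_vector cext \<Rightarrow> 'w cext" where
  "cext_scale c (Fin w) = Fin (c *\<^sub>R w)"
| "cext_scale c PInf = PInf"

definition closed_convex_pointed_solid_cone :: "'w::euclidean_space set \<Rightarrow> bool" where
  "closed_convex_pointed_solid_cone C \<longleftrightarrow>
     cone C \<and> closed C \<and> convex C \<and> C \<inter> uminus ` C = {0} \<and> interior C \<noteq> {}"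

fun preceq :: "'w::euclidean_space set \<Rightarrow> 'w cext \<Rightarrow> 'w cext \<Rightarrow> bool" where
  "preceq C (Fin v) (Fin w) \<longleftrightarrow> w - v \<in> C"
| "preceq C _ PInf \<longleftrightarrow> True"
| "preceq C PInf (Fin w) \<longleftrightarrow> False"

fun prec :: "'w::euclidean_space set \<Rightarrow> 'w cext \<Rightarrow> 'w cext \<Rightarrow> bool" where
  "prec C (Fin v) (Fin w) \<longleftrightarrow> w - v \<in> interior C"
| "prec C (Fin v) PInf \<longleftrightarrow> True"
| "prec C PInf _ \<longleftrightarrow> False"

definition set_prec :: "'w::euclidean_space set \<Rightarrow> 'w cext set \<Rightarrow> 'w cext set \<Rightarrow> bool" where
  "set_prec C U V \<longleftrightarrow> (\<forall>v\<in>V. \<exists>u\<in>U. prec C u v)"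

definition dual_cone :: "'w::euclidean_space set \<Rightarrow> 'w set" where
  "dual_cone C = {z. \<forall>w\<in>C. w \<bullet> z \<ge> 0}"

fun pairing :: "'w::euclidean_space \<Rightarrow> 'w cext \<Rightarrow> ereal" where
  "pairing z (Fin w) = ereal (z \<bullet> w)"
| "pairing z PInf = \<infinity>"

definition lsc :: "('n::euclidean_space \<Rightarrow> ereal) \<Rightarrow> bool" where
  "lsc \<phi> \<longleftrightarrow> (\<forall>x. \<phi> x \<le> Liminf (at x) \<phi>)"

definition C_convex ::
  "'w::euclidean_space set \<Rightarrow> ('n::euclidean_space \<Rightarrow> 'w cext) \<Rightarrow> bool" where
  "C_convex C g \<longleftrightarrow>
     (\<forall>x y. \<forall>t\<in>{0<..1}.
        preceq C (g (t *\<^sub>R x + (1 - t) *\<^sub>R y))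
                 (cext_add (cext_scale t (g x)) (cext_scale (1 - t) (g y))))"

definition C_proper :: "('n \<Rightarrow> 'w cext) \<Rightarrow> bool" where
  "C_proper g \<longleftrightarrow> (\<exists>x. g x \<noteq> PInf)"

definition C_closed ::
  "'w::euclidean_space set \<Rightarrow> ('n::euclidean_space \<Rightarrow> 'w cext) \<Rightarrow> bool" where
  "C_closed C g \<longleftrightarrow> (\<forall>z \<in> dual_cone C - {0}. lsc (\<lambda>x. pairing z (g x)))"

definition cont_differentiable :: "('n::euclidean_space \<Rightarrow> 'w::euclidean_space) \<Rightarrow> bool" where
  "cont_differentiable f \<longleftrightarrow>
     (\<exists>D :: 'n \<Rightarrow> 'n \<Rightarrow>\<^sub>L 'w.
        (\<forall>x. (f has_derivative blinfun_apply (D x)) (at x)) \<and> continuous_on UNIV D)"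

definition values_set :: "nat \<Rightarrow> (nat \<Rightarrow> 'n \<Rightarrow> 'w cext) \<Rightarrow> 'n \<Rightarrow> 'w cext set" where
  "values_set p h x = (\<lambda>j. h j x) ` {1..p}"

definition minimal_set :: "'w::euclidean_space set \<Rightarrow> 'w cext set \<Rightarrow> 'w cext set" where
  "minimal_set C U = {u \<in> U. \<not> (\<exists>u'\<in>U. u' \<noteq> u \<and> preceq C u' u)}"

definition cardinality_fn ::
  "'w::euclidean_space set \<Rightarrow> nat \<Rightarrow> (nat \<Rightarrow> 'n \<Rightarrow> 'w cext) \<Rightarrow> 'n \<Rightarrow> nat" where
  "cardinality_fn C p h x = card (minimal_set C (values_set p h x))"

definition active_indices ::
  "nat \<Rightarrow> (nat \<Rightarrow> 'n \<Rightarrow> 'w cext) \<Rightarrow> 'n \<Rightarrow> 'w cext \<Rightarrow> nat set" where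
  "active_indices p h x u = {j \<in> {1..p}. h j x = u}"

definition enumerates_minimal ::
  "'w::euclidean_space set \<Rightarrow> nat \<Rightarrow> (nat \<Rightarrow> 'n \<Rightarrow> 'w cext) \<Rightarrow> 'n \<Rightarrow> (nat \<Rightarrow> 'w cext) \<Rightarrow> bool" where
  "enumerates_minimal C p h x u \<longleftrightarrow>
     bij_betw u {1..cardinality_fn C p h x} (minimal_set C (values_set p h x))"

text \<open>The partition set at \<open>x\<close> with respect to an enumeration \<open>u\<close> of the minimal elements; tuples
  of indices are extensional functions on \<open>{1..\<omega>(x)}\<close>.\<close>

definition partition_set ::
  "'w::euclidean_space set \<Rightarrow> nat \<Rightarrow> (nat \<Rightarrow> 'n \<Rightarrow> 'w cext) \<Rightarrow> 'n \<Rightarrow> (nat \<Rightarrow> 'w cext)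
     \<Rightarrow> (nat \<Rightarrow> nat) set" where
  "partition_set C p h x u =
     (\<Pi>\<^sub>E j\<in>{1..cardinality_fn C p h x}. active_indices p h x (u j))"

definition local_weakly_minimal ::
  "'w::euclidean_space set \<Rightarrow> ('n::euclidean_space \<Rightarrow> 'w cext set) \<Rightarrow> 'n \<Rightarrow> bool" where
  "local_weakly_minimal C H y0 \<longleftrightarrow>
     (\<exists>N. open N \<and> y0 \<in> N \<and> \<not> (\<exists>y\<in>N. set_prec C (H y) (H y0)))"

text \<open>A vector objective with \<open>k\<close> blocks is a map \<open>F\<close> into functions of which only the values at
  \<open>1, \<dots>, k\<close> matter; the image is ordered by the product cone \<open>C \<times> \<dots> \<times> C\<close> (\<open>k\<close> times).\<close>

definition prod_prec ::
  "'w::euclidean_space set \<Rightarrow> nat \<Rightarrow> (nat \<Rightarrow> 'w cext) \<Rightarrow> (nat \<Rightarrow> 'w cext) \<Rightarrow> bool" where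
  "prod_prec C k v w \<longleftrightarrow> (\<forall>j\<in>{1..k}. prec C (v j) (w j))"

definition local_weakly_efficient ::
  "'w::euclidean_space set \<Rightarrow> nat \<Rightarrow> ('n::euclidean_space \<Rightarrow> nat \<Rightarrow> 'w cext) \<Rightarrow> 'n \<Rightarrow> bool" where
  "local_weakly_efficient C k F y0 \<longleftrightarrow>
     (\<exists>N. open N \<and> y0 \<in> N \<and> \<not> (\<exists>y\<in>N. prod_prec C k (F y) (F y0)))"

definition tilde :: "(nat \<Rightarrow> 'n \<Rightarrow> 'w cext) \<Rightarrow> (nat \<Rightarrow> nat) \<Rightarrow> 'n \<Rightarrow> nat \<Rightarrow> 'w cext" where
  "tilde h a x = (\<lambda>j. h (a j) x)"

end

(* If H(y) is strictly below H(ybar), every minimal value u_j of H(ybar) lies strictly above some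
   h^{a_j}(y). For y close to ybar, lower semicontinuity forces h^{a_j}(ybar) to be below u_j, so
   both agree by minimality of u_j. Hence a lies in the partition set and y contradicts the local
   weak efficiency of ybar for a. As there are only finitely many indices and finitely many a,
   a common neighborhood exists. *)
theory Submission
  imports Defs
begin

text \<open>A hyperplane strictly separates \<open>d\<close> from the closed convex set
  \<open>C\<close>. Since \<open>C\<close> is a cone, a linear functional bounded below on it is
  nonnegative on it, so the normal of the hyperplane lies in the dual cone.\<close>

lemma dual_cone_separation:
  fixes C :: "'w::euclidean_space set"
  assumes "cone C" "closed C" "convex C" "C \<noteq> {}" "d \<notin> C"
  obtains z where "z \<in> dual_cone C - {0}" "z \<bullet> d < 0"
proof -
  obtain z b where zb: "z \<bullet> d < b" "\<And>x. x \<in> C \<Longrightarrow> z \<bullet> x > b"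
    using separating_hyperplane_closed_point[of C d] assms by auto
  have "0 \<in> C"
    using \<open>cone C\<close> \<open>C \<noteq> {}\<close> cone_contains_0 by blast
  with zb(2)[of 0] have "b < 0"
    by simp
  have "z \<bullet> x \<ge> 0" if "x \<in> C" for x
  proof (rule ccontr)
    assume neg: "\<not> z \<bullet> x \<ge> 0"
    with \<open>b < 0\<close> have "b / (z \<bullet> x) \<ge> 0"
      by (simp add: divide_nonpos_neg)
    \<comment> \<open>The factor scales \<open>x\<close> to a point of the cone where the functional
      equals exactly \<open>b\<close>, against the strict bound.\<close>
    then have "(b / (z \<bullet> x)) *\<^sub>R x \<in> C"
      using \<open>cone C\<close> that by (simp add: cone_def)
    from zb(2)[OF this] neg show False
      by simp
  qed
  then have "z \<in> dual_cone C"
    by (simp add: dual_cone_def inner_commute)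
  moreover have "z \<bullet> d < 0"
    using zb(1) \<open>b < 0\<close> by simp
  ultimately show thesis
    using that[of z] by fastforce
qed

text \<open>Provides a point outside \<open>C\<close>; separating it from \<open>C\<close> shows
  that the dual cone has a nonzero element.\<close>

lemma pointed_cone_neq_UNIV:
  fixes C :: "'w::euclidean_space set"
  assumes "C \<inter> uminus ` C = {0}"
  shows "C \<noteq> UNIV"
proof
  assume "C = UNIV"
  then have "(UNIV :: 'w set) = {0}"
    using assms by (simp add: surj_uminus)
  then show False
    using nonempty_Basis nonzero_Basis by fastforce
qed

text \<open>This is the bipolar theorem, extended to values that may be \<open>PInf\<close>: a
  closed convex cone is cut out by its nonzero dual functionals, so the order can be tested on
  scalars.\<close>

lemma preceq_if_dual_le:
  fixes C :: "'w::euclidean_space set"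
  assumes C: "closed_convex_pointed_solid_cone C"
    and le: "\<And>z. z \<in> dual_cone C - {0} \<Longrightarrow> pairing z v \<le> pairing z w"
  shows "preceq C v w"
proof (rule ccontr)
  assume not: "\<not> preceq C v w"
  then obtain w' where w: "w = Fin w'"
    by (cases w; cases v) auto
  have "cone C" "closed C" "convex C" "C \<noteq> {}"
    using C by (auto simp: closed_convex_pointed_solid_cone_def)
  note sep = dual_cone_separation[OF this]
  show False
  proof (cases v)
    case (Fin v')
    with not w have "w' - v' \<notin> C"
      by simp
    then obtain z where "z \<in> dual_cone C - {0}" "z \<bullet> (w' - v') < 0"
      by (rule sep)
    with le[of z] Fin w show False
      by (simp add: inner_diff_right)
  next
    \<comment> \<open>Here \<open>w\<close> is finite while every pairing with \<open>v\<close> is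
      infinite, so any single nonzero dual functional refutes \<open>le\<close>.\<close>
    case PInf
    obtain d where "d \<notin> C"
      using C pointed_cone_neq_UNIV by (auto simp: closed_convex_pointed_solid_cone_def)
    then obtain z where "z \<in> dual_cone C - {0}"
      by (rule sep)
    with le[of z] PInf w show False
      by simp
  qed
qed

lemma pairing_le_if_prec:
  assumes "prec C v w" "z \<in> dual_cone C"
  shows "pairing z v \<le> pairing z w"
proof (cases v; cases w)
  fix v' w' assume "v = Fin v'" "w = Fin w'"
  with assms have "w' - v' \<in> C"
    using interior_subset by auto
  with assms(2) have "(w' - v') \<bullet> z \<ge> 0"
    by (auto simp: dual_cone_def)
  then show ?thesis
    using \<open>v = _\<close> \<open>w = _\<close> by (simp add: inner_diff_left inner_commute[of z])
qed (use assms in auto)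

lemma lsc_eventually_gt:
  assumes "lsc \<phi>" "c < \<phi> x"
  shows "\<forall>\<^sub>F y in nhds x. c < \<phi> y"
proof -
  have "c < Liminf (at x) \<phi>"
    using assms by (auto simp: lsc_def intro: less_le_trans)
  then have "\<forall>\<^sub>F y in at x. c < \<phi> y"
    by (rule less_LiminfD)
  \<comment> \<open>The \<open>Liminf\<close> sees only the punctured neighbourhood; the point
    \<open>x\<close> itself is covered by the second assumption.\<close>
  with assms(2) show ?thesis
    by (simp add: eventually_nhds_conv_at)
qed

lemma pairing_cext_add:
  "pairing z (cext_add (Fin v) w) = ereal (z \<bullet> v) + pairing z w"
  by (cases w) (auto simp: inner_add_right)

lemma cont_differentiable_isCont:
  "cont_differentiable f \<Longrightarrow> isCont f x"
  unfolding cont_differentiable_def using has_derivative_continuous by blast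

text \<open>If some dual functional \<open>z\<close> violated the order at \<open>x\<close>, lower
  semicontinuity of the scalarised sum would keep the strict violation on a whole neighbourhood,
  leaving no \<open>y\<close> there with a value strictly below \<open>w\<close>.\<close>

lemma preceq_if_frequently_prec:
  fixes f :: "'n::euclidean_space \<Rightarrow> 'w::euclidean_space"
  assumes C: "closed_convex_pointed_solid_cone C"
    and f: "isCont f x"
    and g: "C_closed C g"
    and freq: "\<exists>\<^sub>F y in nhds x. prec C (cext_add (Fin (f y)) (g y)) w"
  shows "preceq C (cext_add (Fin (f x)) (g x)) w"
proof (rule preceq_if_dual_le[OF C], rule ccontr)
  fix z
  assume z: "z \<in> dual_cone C - {0}"
    and "\<not> pairing z (cext_add (Fin (f x)) (g x)) \<le> pairing z w"
  then have gt: "pairing z w < ereal (z \<bullet> f x) + pairing z (g x)"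
    by (simp add: pairing_cext_add)
  then obtain w' where w: "w = Fin w'"
    by (cases w) auto
  have "ereal (z \<bullet> w' - z \<bullet> f x) < pairing z (g x)"
    using gt w by (cases "pairing z (g x)") auto
  \<comment> \<open>A real \<open>c\<close> inside the gap lets the continuous part and the lower
    semicontinuous part be estimated separately, also when \<open>pairing z (g x)\<close> is
    infinite.\<close>
  then obtain c where c: "z \<bullet> w' - z \<bullet> f x < c" "ereal c < pairing z (g x)"
    using ereal_dense2 by (metis ereal_less_eq(3) not_le)
  have "((\<lambda>y. z \<bullet> w' - z \<bullet> f y) \<longlongrightarrow> z \<bullet> w' - z \<bullet> f x) (nhds x)"
    using f by (intro tendsto_intros) (simp add: isCont_def tendsto_at_iff_tendsto_nhds)
  then have "\<forall>\<^sub>F y in nhds x. z \<bullet> w' - z \<bullet> f y < c"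
    using c(1) by (rule order_tendstoD)
  moreover have "\<forall>\<^sub>F y in nhds x. ereal c < pairing z (g y)"
    using g z c(2) by (intro lsc_eventually_gt) (auto simp: C_closed_def)
  ultimately have "\<forall>\<^sub>F y in nhds x. \<not> prec C (cext_add (Fin (f y)) (g y)) w"
  proof eventually_elim
    case (elim y)
    then have "ereal (z \<bullet> w') < ereal (z \<bullet> f y) + pairing z (g y)"
      by (cases "pairing z (g y)") auto
    then show ?case
      using pairing_le_if_prec[of C "cext_add (Fin (f y)) (g y)" w z] z w
      by (auto simp: pairing_cext_add)
  qed
  with freq show False
    by (simp add: frequently_def)
qed

lemma finite_partition_set: "finite (partition_set C p h x u)"
  by (simp add: partition_set_def active_indices_def finite_PiE)

lemma local_weakly_minimal_iff_eventually:
  "local_weakly_minimal C H x \<longleftrightarrow> (\<forall>\<^sub>F y in nhds x. \<not> set_prec C (H y) (H x))"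
  by (auto simp: local_weakly_minimal_def eventually_nhds)

lemma local_weakly_efficient_iff_eventually:
  "local_weakly_efficient C k F x \<longleftrightarrow> (\<forall>\<^sub>F y in nhds x. \<not> prod_prec C k (F y) (F x))"
  by (auto simp: local_weakly_efficient_def eventually_nhds)

text \<open>The analysis enters through \<open>lower\<close>; what remains is a choice among
  finitely many indices.\<close>

lemma local_weakly_minimal_if_partition_efficient:
  fixes h :: "nat \<Rightarrow> 'n::euclidean_space \<Rightarrow> 'w::euclidean_space cext"
  assumes lower: "\<And>i w. i \<in> {1..p} \<Longrightarrow> \<exists>\<^sub>F y in nhds x. prec C (h i y) w \<Longrightarrow> preceq C (h i x) w"
    and enum: "enumerates_minimal C p h x u"
    and eff: "\<And>a. a \<in> partition_set C p h x u \<Longrightarrow>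
           local_weakly_efficient C (cardinality_fn C p h x) (tilde h a) x"
  shows "local_weakly_minimal C (values_set p h) x"
proof -
  let ?k = "cardinality_fn C p h x"
  have min: "u j \<in> minimal_set C (values_set p h x)" if "j \<in> {1..?k}" for j
    using enum that by (auto simp: enumerates_minimal_def bij_betw_def)
  \<comment> \<open>All tuples are treated at once, because the tuple used below is chosen only
    after \<open>y\<close>.\<close>
  have "\<forall>\<^sub>F y in nhds x. \<forall>a\<in>partition_set C p h x u.
      \<not> prod_prec C ?k (tilde h a y) (tilde h a x)"
    using eff finite_partition_set
    by (auto simp: local_weakly_efficient_iff_eventually intro!: eventually_ball_finite)
  moreover have "\<forall>\<^sub>F y in nhds x. \<forall>i\<in>{1..p}. \<forall>j\<in>{1..?k}.
      prec C (h i y) (u j) \<longrightarrow> preceq C (h i x) (u j)"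
  proof (intro eventually_ball_finite ballI finite_atLeastAtMost)
    fix i j assume "i \<in> {1..p}"
    then show "\<forall>\<^sub>F y in nhds x. prec C (h i y) (u j) \<longrightarrow> preceq C (h i x) (u j)"
      \<comment> \<open>Either the conclusion holds at \<open>x\<close> and the implication is
        trivial, or the contrapositive of \<open>lower\<close> makes its premise fail near
        \<open>x\<close>.\<close>
      using lower[of i "u j"] by (cases "preceq C (h i x) (u j)") (auto simp: frequently_def)
  qed
  ultimately have "\<forall>\<^sub>F y in nhds x. \<not> set_prec C (values_set p h y) (values_set p h x)"
  proof eventually_elim
    case (elim y)
    show ?case
    proof
      assume "set_prec C (values_set p h y) (values_set p h x)"
      then have "\<forall>j\<in>{1..?k}. \<exists>i\<in>{1..p}. prec C (h i y) (u j)"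
        using min by (fastforce simp: set_prec_def minimal_set_def values_set_def)
      then obtain b where b: "\<And>j. j \<in> {1..?k} \<Longrightarrow> b j \<in> {1..p} \<and> prec C (h (b j) y) (u j)"
        by metis
      have eq: "h (b j) x = u j" if "j \<in> {1..?k}" for j
      proof -
        have "preceq C (h (b j) x) (u j)"
          using elim(2) b that by blast
        moreover have "h (b j) x \<in> values_set p h x"
          using b that by (simp add: values_set_def)
        ultimately show ?thesis
          using min[OF that] by (auto simp: minimal_set_def)
      qed
      \<comment> \<open>Tuples are extensional functions, so the choice function \<open>b\<close> is
        cut down to the index range.\<close>
      have "restrict b {1..?k} \<in> partition_set C p h x u"
        using b eq by (auto simp: partition_set_def active_indices_def)
      moreover have "prod_prec C ?k (tilde h (restrict b {1..?k}) y) (tilde h (restrict b {1..?k}) x)"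
        using b eq by (simp add: prod_prec_def tilde_def)
      ultimately show False
        using elim(1) by blast
    qed
  qed
  then show ?thesis
    by (simp add: local_weakly_minimal_iff_eventually)
qed

theorem lemma3p1:
  fixes C :: "(real ^ 'm) set"
    and p :: nat
    and f :: "nat \<Rightarrow> real ^ 'n \<Rightarrow> real ^ 'm"
    and g h :: "nat \<Rightarrow> real ^ 'n \<Rightarrow> (real ^ 'm) cext"
    and ybar :: "real ^ 'n"
    and u :: "nat \<Rightarrow> (real ^ 'm) cext"
  assumes "closed_convex_pointed_solid_cone C"
    and "\<And>j. j \<in> {1..p} \<Longrightarrow> cont_differentiable (f j)"
    and "\<And>j. j \<in> {1..p} \<Longrightarrow> C_proper (g j)"
    and "\<And>j. j \<in> {1..p} \<Longrightarrow> C_closed C (g j)"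
    and "\<And>j. j \<in> {1..p} \<Longrightarrow> C_convex C (g j)"
    and "\<And>j x. j \<in> {1..p} \<Longrightarrow> h j x = cext_add (Fin (f j x)) (g j x)"
    and "enumerates_minimal C p h ybar u"
    and "\<And>a. a \<in> partition_set C p h ybar u \<Longrightarrow>
           local_weakly_efficient C (cardinality_fn C p h ybar) (tilde h a) ybar"
  shows "local_weakly_minimal C (values_set p h) ybar"
proof (rule local_weakly_minimal_if_partition_efficient[OF _ assms(7,8)])
  fix i w
  assume "i \<in> {1..p}" "\<exists>\<^sub>F y in nhds ybar. prec C (h i y) w"
  then show "preceq C (h i ybar) w"
    \<comment> \<open>The smooth part is continuous and \<open>g i\<close> is closed, which yields
      the \<open>lower\<close> condition for their sum.\<close>
    using preceq_if_frequently_prec[where f = "f i" and g = "g i" and C = C and x = ybar and w = w] assms(1,2,4,6)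
    by (simp add: cont_differentiable_isCont)
qed

end
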